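(* Let $0<\delta<1$, and let $y_0,y_1,y_2,\ldots\in C[0,1]$ be the solution components of the homotopy analysis scheme (with convergence-control parameter $c_0\neq 0$) described in the context. Suppose there exists $k_0\in\mathbb{N}$ such that $\|y_{k+1}\|\le\delta\,\|y_k\|$ for all $k\ge k_0$. Assume that the series solution $\sum_{k=0}^{\infty}y_k(x)$ converges to $y(x)$. If the truncated series $\phi_m(x,c_0)=\sum_{k=0}^{m}y_k(x,c_0)$ is used as an approximation to the solution $y(x)$, then the maximum absolute truncated error is estimated as $$\left|y(x)-\phi_m(x,c_0)\right|\le\frac{\delta^{\,m-k_0+1}}{1-\delta}\,\|y_{k_0}\|.$$
   Context: $C[0,1]$ is the Banach space of continuous real functions on $[0,1]$ with the norm $\|y\|=\max_{x\in[0,1]}|y(x)|$. Consider the nonlocal boundary value problem $\alpha(p)\,y''(x)=f(y(x))$, $x\in(0,1)$, $y(0)=a$, $y(1)=b$, with $a,b\in[0,\infty)$ and $p=\int_0^1 y(s)\,ds$. Here $\alpha$ is a continuous positive function, and either $f(y(x))\equiv -h(x)$ for a given function $h$, or $f(y(x))\equiv y^{2n+1}(x)$ with $n$ a nonnegative integer. It is rewritten as the integral equation $$y(x)=a+(b-a)x+\frac{1}{\alpha(p)}\int_0^1 G(x,s)f(y(s))\,ds,$$ where $G(x,s)=x(s-1)$ for $x\le s$ and $G(x,s)=s(x-1)$ for $s\le x$. Solution components: fix $c_0\neq 0$ (the convergence-control parameter). Put $y_0(x)=a+(b-a)x$ and, for $k\ge 1$, $$y_k(x)-\chi_k\,y_{k-1}(x)=c_0\Big[y_{k-1}(x)-(1-\chi_k)\big(a+(b-a)x\big)-\frac{1}{\alpha(p_{k-1})}\int_0^1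 G(x,s)\,\mathcal{H}_{k-1}(s)\,ds\Big],$$ where $\chi_k=0$ for $k\le 1$ and $\chi_k=1$ for $k>1$, $p_k=\int_0^1\sum_{j=0}^{k}y_j(s)\,ds$, and $$\mathcal{H}_k(s)=\frac{1}{k!}\frac{\partial^k}{\partial q^k}\Big\{f\Big(\sum_{j=0}^{k}y_j(s)q^j\Big)\Big\}\Big|_{q=0}.$$ The components $y_k=y_k(x)=y_k(x,c_0)$ depend on $c_0$ and are regarded as elements of $C[0,1]$.
   Formalization: The bound is stated only for m with m+1 ≥ k_0 (nonnegative exponent); for smaller m it can fail, e.g. α=1, f=-h with h=1, c_0=-1, k_0=2, m=0, where y_1=x(1-x)/2 and y_k=0 for k≥2. *)

theory Defs
  imports "HOL-Analysis.Analysis"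
begin

text \<open>Elements of \<open>C[0,1]\<close> are functions on the reals that are continuous on \<open>{0..1}\<close>; their values
  outside the interval are irrelevant throughout.\<close>

definition C01_norm :: "(real \<Rightarrow> real) \<Rightarrow> real" where
  "C01_norm u = (SUP x\<in>{0..1}. \<bar>u x\<bar>)"

text \<open>For continuous \<open>u\<close> the supremum is the maximum.\<close>

lemma C01_norm_attained:
  assumes "continuous_on {0..1} u"
  shows "\<exists>x\<in>{0..1}. C01_norm u = \<bar>u x\<bar> \<and> (\<forall>z\<in>{0..1}. \<bar>u z\<bar> \<le> \<bar>u x\<bar>)"
proof -
  have "continuous_on {0..1} (\<lambda>x. \<bar>u x\<bar>)"
    using assms by (intro continuous_intros)
  then obtain x where x: "x \<in> {0..1}" "\<forall>z\<in>{0..1}. \<bar>u z\<bar> \<le> \<bar>u x\<bar>"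
    using continuous_attains_sup[of "{0..1::real}" "\<lambda>x. \<bar>u x\<bar>"] by auto
  have "C01_norm u = \<bar>u x\<bar>"
    unfolding C01_norm_def using x by (intro cSup_eq_maximum) auto
  with x show ?thesis by blast
qed

definition green :: "real \<Rightarrow> real \<Rightarrow> real" where
  "green x s = (if x \<le> s then x * (s - 1) else s * (x - 1))"

text \<open>The right-hand side \<open>f(y(x))\<close> is rendered as \<open>f x (y x)\<close>, so that the case \<open>f(y(x)) = -h(x)\<close>,
  which depends on \<open>x\<close> only, fits the same type as \<open>f(y(x)) = y(x)^(2n+1)\<close>. All that is required
  of \<open>h\<close> is that the integrals of \<open>G(x,s) h(s)\<close> exist.\<close>

definition admissible_rhs :: "(real \<Rightarrow> real \<Rightarrow> real) \<Rightarrow> bool" where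
  "admissible_rhs f \<longleftrightarrow>
     (\<exists>h. (\<forall>x\<in>{0..1}. (\<lambda>s. green x s * h s) integrable_on {0..1}) \<and> f = (\<lambda>x v. - h x)) \<or>
     (\<exists>n::nat. f = (\<lambda>x v. v ^ (2 * n + 1)))"

definition partial_mean :: "(nat \<Rightarrow> real \<Rightarrow> real) \<Rightarrow> nat \<Rightarrow> real" where
  "partial_mean y k = integral {0..1} (\<lambda>s. \<Sum>j\<le>k. y j s)"

definition homotopy_poly ::
  "(real \<Rightarrow> real \<Rightarrow> real) \<Rightarrow> (nat \<Rightarrow> real \<Rightarrow> real) \<Rightarrow> nat \<Rightarrow> real \<Rightarrow> real" where
  "homotopy_poly f y k s =
     (1 / fact k) * (deriv ^^ k) (\<lambda>q::real. f s (\<Sum>j\<le>k. y j s * q ^ j)) 0"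

definition chi :: "nat \<Rightarrow> real" where
  "chi k = (if k \<le> 1 then 0 else 1)"

definition ham_components ::
  "(real \<Rightarrow> real) \<Rightarrow> (real \<Rightarrow> real \<Rightarrow> real) \<Rightarrow> real \<Rightarrow> real \<Rightarrow> real \<Rightarrow> (nat \<Rightarrow> real \<Rightarrow> real) \<Rightarrow> bool" where
  "ham_components \<alpha> f a b c0 y \<longleftrightarrow>
     (\<forall>x\<in>{0..1}. y 0 x = a + (b - a) * x) \<and>
     (\<forall>k\<ge>1. \<forall>x\<in>{0..1}.
        y k x - chi k * y (k - 1) x =
          c0 * (y (k - 1) x - (1 - chi k) * (a + (b - a) * x)
            - (1 / \<alpha> (partial_mean y (k - 1))) *
              integral {0..1} (\<lambda>s. green x s * homotopy_poly f y (k - 1) s)))"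

definition truncated_series :: "(nat \<Rightarrow> real \<Rightarrow> real) \<Rightarrow> nat \<Rightarrow> real \<Rightarrow> real" where
  "truncated_series y m x = (\<Sum>k\<le>m. y k x)"

end

theory Submission
  imports Defs
begin

text \<open>The truncation error at \<open>x\<close> is the tail \<open>y_(m+1)(x) + y_(m+2)(x) + \<dots>\<close> of the series. Once the
  index has passed \<open>k0\<close>, each component is smaller than its predecessor by the factor \<open>\<delta>\<close> in the
  maximum norm, so iterating gives \<open>\<parallel>y_k\<parallel> \<le> \<delta>^(k-k0) \<parallel>y_k0\<parallel>\<close> (\<open>geometric_decay_of_ratio\<close>). Since
  point values are dominated by the norm, the tail is dominated term by term by a geometric series
  with first term \<open>\<delta>^(m+1-k0) \<parallel>y_k0\<parallel>\<close> and ratio \<open>\<delta>\<close> (\<open>sums_tail_le_geometric\<close>). The resulting bound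
  does not depend on \<open>x\<close>, and therefore also bounds the supremum of the error. This is the ratio
  test with an explicit remainder. Continuity of the components enters where point values are
  compared with the norm: it makes the supremum that defines the norm finite.\<close>

lemma abs_le_C01_norm:
  assumes "continuous_on {0..1} u" and "x \<in> {0..1}"
  shows "\<bar>u x\<bar> \<le> C01_norm u"
  using C01_norm_attained[OF assms(1)] assms(2) by auto

lemma C01_norm_le:
  assumes "\<And>x. x \<in> {0..1} \<Longrightarrow> \<bar>u x\<bar> \<le> B"
  shows "C01_norm u \<le> B"
  unfolding C01_norm_def using assms by (intro cSUP_least) auto

lemma geometric_decay_of_ratio:
  fixes N :: "nat \<Rightarrow> real"
  assumes "0 \<le> d" and ratio: "\<And>k. n \<le> k \<Longrightarrow> N (Suc k) \<le> d * N k"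
  shows "N (n + j) \<le> d ^ j * N n"
proof (induction j)
  case 0
  show ?case by simp
next
  case (Suc j)
  have "N (n + Suc j) \<le> d * N (n + j)"
    using ratio[of "n + j"] by simp
  also have "\<dots> \<le> d * (d ^ j * N n)"
    using Suc.IH \<open>0 \<le> d\<close> by (rule mult_left_mono)
  finally show ?case by (simp add: mult.assoc)
qed

text \<open>The difference on the left is the tail from \<open>n\<close> on, which the geometric series
  \<open>B + B * d + B * d^2 + \<dots>\<close> majorises term by term.\<close>

lemma sums_tail_le_geometric:
  fixes g :: "nat \<Rightarrow> real"
  assumes "g sums s" and "0 \<le> d" and "d < 1"
    and dominated: "\<And>i. \<bar>g (i + n)\<bar> \<le> B * d ^ i"
  shows "\<bar>s - (\<Sum>k<n. g k)\<bar> \<le> B / (1 - d)"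
proof -
  have tail: "(\<lambda>i. g (i + n)) sums (s - (\<Sum>k<n. g k))"
    using \<open>g sums s\<close> by (rule sums_split_initial_segment)
  have majorant: "(\<lambda>i. B * d ^ i) sums (B * (1 / (1 - d)))"
    using assms(2,3) by (intro sums_mult geometric_sums) simp
  have "norm (\<Sum>i. g (i + n)) \<le> (\<Sum>i. B * d ^ i)"
    using dominated sums_summable[OF majorant] by (intro norm_suminf_le) auto
  then show ?thesis
    using sums_unique[OF tail] sums_unique[OF majorant] by simp
qed

theorem theorem3p2:
  fixes a b c0 \<delta> :: real
    and \<alpha> :: "real \<Rightarrow> real" and D :: "real set"
    and f :: "real \<Rightarrow> real \<Rightarrow> real"
    and y :: "nat \<Rightarrow> real \<Rightarrow> real" and y_lim :: "real \<Rightarrow> real"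
    and k0 m :: nat
  assumes "0 \<le> a" and "0 \<le> b"
    and "continuous_on D \<alpha>" and "\<forall>p\<in>D. 0 < \<alpha> p"
    and "admissible_rhs f"
    and "c0 \<noteq> 0"
    and "ham_components \<alpha> f a b c0 y"
    and "\<forall>k. partial_mean y k \<in> D"
    and "\<forall>k. continuous_on {0..1} (y k)"
    and "0 < \<delta>" and "\<delta> < 1"
    and "\<forall>k\<ge>k0. C01_norm (y (k + 1)) \<le> \<delta> * C01_norm (y k)"
    and "\<forall>x\<in>{0..1}. (\<lambda>k. y k x) sums y_lim x"
    and "k0 \<le> m + 1"
  shows "(\<forall>x\<in>{0..1}. \<bar>y_lim x - truncated_series y m x\<bar>
            \<le> \<delta> ^ (m + 1 - k0) / (1 - \<delta>) * C01_norm (y k0)) \<and>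
         C01_norm (\<lambda>x. y_lim x - truncated_series y m x)
            \<le> \<delta> ^ (m + 1 - k0) / (1 - \<delta>) * C01_norm (y k0)"
proof -
  let ?N = "\<lambda>k. C01_norm (y k)"
  let ?n = "m + 1"
  have cont: "continuous_on {0..1} (y k)" for k
    using assms by blast
  have ratio: "?N (Suc k) \<le> \<delta> * ?N k" if "k0 \<le> k" for k
    using assms(12) that by simp
  have pointwise: "\<bar>y_lim x - truncated_series y m x\<bar>
      \<le> \<delta> ^ (?n - k0) / (1 - \<delta>) * ?N k0" if x: "x \<in> {0..1}" for x
  proof -
    have dominated: "\<bar>y (i + ?n) x\<bar> \<le> (\<delta> ^ (?n - k0) * ?N k0) * \<delta> ^ i" for i
    proof -
      \<comment> \<open>The bound \<open>k0 \<le> m + 1\<close> makes the truncated difference \<open>m + 1 - k0\<close> a genuine one; for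
        \<open>k0 = m + 1\<close> the decay starts exactly at the first term of the tail.\<close>
      have split: "i + ?n = k0 + ((?n - k0) + i)"
        using \<open>k0 \<le> m + 1\<close> by simp
      have "\<bar>y (i + ?n) x\<bar> \<le> ?N (i + ?n)"
        using cont x by (rule abs_le_C01_norm)
      also have "\<dots> \<le> \<delta> ^ ((?n - k0) + i) * ?N k0"
        unfolding split using \<open>0 < \<delta>\<close> ratio
        by (intro geometric_decay_of_ratio[where N = ?N]) auto
      also have "\<dots> = (\<delta> ^ (?n - k0) * ?N k0) * \<delta> ^ i"
        by (simp only: power_add mult_ac)
      finally show ?thesis .
    qed
    have "(\<lambda>k. y k x) sums y_lim x"
      using assms(13) x by blast
    from sums_tail_le_geometric[OF this _ \<open>\<delta> < 1\<close> dominated] \<open>0 < \<delta>\<close>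
    have "\<bar>y_lim x - (\<Sum>k<?n. y k x)\<bar> \<le> (\<delta> ^ (?n - k0) * ?N k0) / (1 - \<delta>)"
      by simp
    moreover have "(\<Sum>k<?n. y k x) = truncated_series y m x"
      by (simp add: truncated_series_def lessThan_Suc_atMost)
    ultimately show ?thesis by simp
  qed
  then show ?thesis
    by (blast intro: C01_norm_le)
qed

end
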